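(* Let $h\ge2$, let $a/b$ be an $h$-Farey fraction with predecessor $a'/b'$, $\Delta\subset\mathbb N$ finite, $\tau,m$ integers, and let $S=S(h,a/b,\Delta,\tau,m)=\langle m,\Gamma\rangle_c$ satisfy the standing assumptions below. Assume $S$ is canonically defined and collision-free. Let $\ell$ be the number of left generators of $S$, $s_i=\left(\!\binom{\ell-1}{i}\!\right)$ for $i\ge0$, $s=\left(\!\binom{\ell}{h}\!\right)$, and let $\omega$ be the number of long elements, i.e. the number of pairs $(i,\lambda)$ with $0\le i\le h-1$ and $\lambda\in i\Gamma$ long. Then the Eliahou number of $S$ is $E=E_0+\rho+\ell\omega$, where $E_0$ admits the four equivalent expressions $E_0=-\ell\sum_{i=0}^{h-1}\phi'_{h-i}s_i+\phi'_h s$, $E_0=-(h-1)s_h+\ell\sum_{i=0}^{h-1}\phi_{h-i}s_i-\phi_h s$, $E_0=-\lfloor h\phi'_1\rfloor s+\ell\sum_{j=1}^{\lfloor h\phi'_1\rfloor}\left(\!\binom{\ell}{h-\lceil j/\phi'_1\rceil}\!\right)$, $E_0=-(h-1)s_h+\lfloor h\phi_1\rfloor s-\ell\sum_{j=1}^{\lfloor h\phi_1\rfloor}\left(\!\binom{\ell}{h-\lceil j/\phi_1\rceil}\!\right)$.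
   Context: For a positive integer $m$, a finite set $\Gamma$ of integers larger than $m$ and an integer $c>m$, $\langle m,\Gamma\rangle_c$ denotes the submonoid of $(\mathbb N,+)$ generated by $m$, the elements of $\Gamma$ and all integers $\ge c$. An element $x>0$ of such $S$ is primitive if it is not the sum of two nonzero elements of $S$; $S$ is canonically defined if $m$ and all elements of $\Gamma$ are primitive and $c-1\notin S$. Parameters (with respect to $c$): $k=|S\cap[0,c)|$; $\ell$ = number of primitive elements of $S$ below $c$ (left generators); $r$ = number of primitive elements of $S$ that are $\ge c$; $s_{\mathrm{crit}}=m-r$; $q=\lceil c/m\rceil$; $\rho=qm-c$; Eliahou number $E=k\ell+qr-c$. For a finite set $A$ and $i\ge0$, $iA=\{a_1+\dots+a_i:a_j\in A\}$ ($0A=\{0\}$). $\left(\!\binom{n}{i}\!\right)=\binom{n+i-1}{i}$. $\{x\}=x-\lfloor x\rfloor$. A finite $A\subset\mathbb Z$ is a $B_h$ set if $|hA|=\left(\!\binom{|A|}{h}\!\right)$. Let $h\ge2$. An $h$-Farey fraction is a reduced fraction $a/b$ with $a\in\mathbb Z$, $1\le b\le h$; its predecessor $a'/b'$ is the largest $h$-Farey fraction strictly less than $a/b$ (in lowest terms, $1\le b'\le h$). For a finite $\Delta\subset\mathbb N$ and integers $\tau,m$, $S(h,a/b,\Delta,\tau,m)=\langle m,\Gamma\rangle_c$ with $c=\lfloor ahm/b\rfloor-m-\tau$ and $\Gamma=\{\lfloor (c+m-1)/h\rfloor-\delta:\delta\in\Delta\}$. Put $\gamma_1=\min\Gamma$,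 $w=c+m-h\gamma_1$. Standing assumptions: all elements of $\Gamma$ exceed $m$; $m\ge w$ (equivalently $h\Gamma\subset[c,c+m)$); and $a'/b'<(c+m)/(hm)\le a/b$. For $1\le i\le h$, $\phi_i=\{-ia/b\}$ and $\phi'_i=\{ia'/b'\}$. An element $\lambda\in i\Gamma$ with $0\le i\le h-1$ is short if $\lceil (c-\lambda)/m\rceil\ge\lfloor (h-i)a'/b'\rfloor$ and long otherwise. $S$ is collision-free if every element of $[c,c+m)$ can be written in a unique way as a combination of generators of $S$; equivalently, $\Gamma$ is a $B_h$ set and the sumsets $i\Gamma$, $0\le i\le h$, are pairwise disjoint modulo $m$.
   Formalization: An element λ of iΓ is called short when ⌈(c−λ)/m⌉ ≤ ⌊(h−i)a'/b'⌋, not ≥: with ≥ every element would be short and the formula fails, e.g. for h=2, a/b=2, Δ={2}, τ=1, m=5 (S=⟨5,7⟩ with c=14). *)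

theory Defs
  imports Complex_Main "HOL-Library.Multiset"
begin

text \<open>
  All numbers, including the elements of numerical semigroups, are of type \<open>int\<close>, so that
  subtraction never truncates; submonoids of the naturals appear as sets of nonnegative integers.
\<close>

inductive_set submonoid_gen :: "'a::comm_monoid_add set \<Rightarrow> 'a set" for G where
  zero: "0 \<in> submonoid_gen G"
| gen: "x \<in> G \<Longrightarrow> x \<in> submonoid_gen G"
| add: "x \<in> submonoid_gen G \<Longrightarrow> y \<in> submonoid_gen G \<Longrightarrow> x + y \<in> submonoid_gen G"

text \<open>The semigroup \<open>\<langle>m,\<Gamma>\<rangle>\<^sub>c\<close>; meant for \<open>0 < m < c\<close> and \<open>\<Gamma>\<close> finite with all elements above \<open>m\<close>.\<close>

definition semigroup_gen :: "int \<Rightarrow> int set \<Rightarrow> int \<Rightarrow> int set" where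
  "semigroup_gen m \<Gamma> c = submonoid_gen ({m} \<union> \<Gamma> \<union> {c..})"

definition primitives :: "int set \<Rightarrow> int set" where
  "primitives S = {x \<in> S. 0 < x \<and> \<not> (\<exists>y\<in>S. \<exists>z\<in>S. y \<noteq> 0 \<and> z \<noteq> 0 \<and> x = y + z)}"

definition canonically_defined :: "int \<Rightarrow> int set \<Rightarrow> int \<Rightarrow> bool" where
  "canonically_defined m \<Gamma> c \<longleftrightarrow>
     m \<in> primitives (semigroup_gen m \<Gamma> c) \<and>
     \<Gamma> \<subseteq> primitives (semigroup_gen m \<Gamma> c) \<and>
     c - 1 \<notin> semigroup_gen m \<Gamma> c"

definition num_left_elements :: "int set \<Rightarrow> int \<Rightarrow> nat" where  \<comment> \<open>the parameter \<open>k\<close>\<close>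
  "num_left_elements S c = card (S \<inter> {0..<c})"

definition num_left_generators :: "int set \<Rightarrow> int \<Rightarrow> nat" where  \<comment> \<open>the parameter \<open>\<ell>\<close>\<close>
  "num_left_generators S c = card {x \<in> primitives S. x < c}"

definition num_right_generators :: "int set \<Rightarrow> int \<Rightarrow> nat" where  \<comment> \<open>the parameter \<open>r\<close>\<close>
  "num_right_generators S c = card {x \<in> primitives S. c \<le> x}"

definition depth :: "int \<Rightarrow> int \<Rightarrow> int" where  \<comment> \<open>the parameter \<open>q\<close>\<close>
  "depth m c = \<lceil>real_of_int c / real_of_int m\<rceil>"

definition rho :: "int \<Rightarrow> int \<Rightarrow> int" where
  "rho m c = depth m c * m - c"

definition eliahou :: "int \<Rightarrow> int \<Rightarrow> int set \<Rightarrow> int" where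
  "eliahou m c S =
     int (num_left_elements S c) * int (num_left_generators S c)
     + depth m c * int (num_right_generators S c) - c"

definition sumset :: "nat \<Rightarrow> int set \<Rightarrow> int set" where
  "sumset i A = {sum_list xs | xs. length xs = i \<and> set xs \<subseteq> A}"

text \<open>
  The truncated subtraction is harmless: for \<open>n = i = 0\<close> the value is 1, and for
  \<open>n = 0 < i\<close> it is 0, in agreement with the number of multisets.
\<close>

definition multichoose :: "nat \<Rightarrow> nat \<Rightarrow> nat" where
  "multichoose n i = (n + i - 1) choose i"

text \<open>Every element of \<open>[c,c+m)\<close> has exactly one representation as a combination of generators;
  a combination is the multiset of the generators used.\<close>

definition collision_free :: "int \<Rightarrow> int \<Rightarrow> int set \<Rightarrow> bool" where
  "collision_free m c S \<longleftrightarrow>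
     (\<forall>x\<in>{c..<c + m}. \<exists>!M :: int multiset. set_mset M \<subseteq> primitives S \<and> \<Sum>\<^sub># M = x)"

definition farey :: "nat \<Rightarrow> int \<Rightarrow> int \<Rightarrow> bool" where
  "farey h a b \<longleftrightarrow> coprime a b \<and> 1 \<le> b \<and> b \<le> int h"

definition farey_predecessor :: "nat \<Rightarrow> int \<Rightarrow> int \<Rightarrow> int \<Rightarrow> int \<Rightarrow> bool" where
  "farey_predecessor h a b a' b' \<longleftrightarrow>
     farey h a' b' \<and> real_of_int a' / real_of_int b' < real_of_int a / real_of_int b \<and>
     (\<forall>x y. farey h x y \<and> real_of_int x / real_of_int y < real_of_int a / real_of_int b
        \<longrightarrow> real_of_int x / real_of_int y \<le> real_of_int a' / real_of_int b')"

text \<open>The data \<open>c\<close> and \<open>\<Gamma>\<close> of the semigroup \<open>S(h,a/b,\<Delta>,\<tau>,m) = \<langle>m,\<Gamma>\<rangle>\<^sub>c\<close>.\<close>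

definition conductor_of :: "nat \<Rightarrow> int \<Rightarrow> int \<Rightarrow> int \<Rightarrow> int \<Rightarrow> int" where
  "conductor_of h a b \<tau> m =
     \<lfloor>real_of_int a * real h * real_of_int m / real_of_int b\<rfloor> - m - \<tau>"

definition Gamma_of :: "nat \<Rightarrow> nat set \<Rightarrow> int \<Rightarrow> int \<Rightarrow> int set" where
  "Gamma_of h \<Delta> m c = (\<lambda>\<delta>. \<lfloor>real_of_int (c + m - 1) / real h\<rfloor> - int \<delta>) ` \<Delta>"

text \<open>
  The condition \<open>m \<ge> w\<close> with \<open>w = c + m - h \<gamma>\<^sub>1\<close> and \<open>\<gamma>\<^sub>1 = min \<Gamma>\<close> is equivalent to \<open>h\<Gamma> \<subseteq> [c,c+m)\<close>,
  hence void for empty \<open>\<Gamma>\<close>, where \<open>Min \<Gamma>\<close> is unspecified.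
\<close>

definition standing :: "nat \<Rightarrow> int \<Rightarrow> int \<Rightarrow> int \<Rightarrow> int \<Rightarrow> int \<Rightarrow> int \<Rightarrow> int set \<Rightarrow> bool" where
  "standing h a b a' b' m c \<Gamma> \<longleftrightarrow>
     (\<forall>\<gamma>\<in>\<Gamma>. m < \<gamma>) \<and>
     (\<Gamma> \<noteq> {} \<longrightarrow> c + m - int h * Min \<Gamma> \<le> m) \<and>
     real_of_int a' / real_of_int b' < real_of_int (c + m) / (real h * real_of_int m) \<and>
     real_of_int (c + m) / (real h * real_of_int m) \<le> real_of_int a / real_of_int b"

text \<open>
  For \<open>x \<in> i\<Gamma>\<close>, \<open>i < h\<close>, the standing assumptions give \<open>\<lceil>(c - x)/m\<rceil> \<ge> \<lfloor>(h - i)a'/b'\<rfloor>\<close>: the left side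
  is at least \<open>(h - i)(c + m)/(h m) - 1 > (h - i)a'/b' - 1\<close>.  Hence this inequality cannot serve to
  tell short elements from long ones; an element is short when equality holds, that is, when the
  reverse inequality below does.
\<close>

definition short :: "nat \<Rightarrow> int \<Rightarrow> int \<Rightarrow> int \<Rightarrow> int \<Rightarrow> nat \<Rightarrow> int \<Rightarrow> bool" where
  "short h a' b' m c i x \<longleftrightarrow>
     \<lceil>real_of_int (c - x) / real_of_int m\<rceil>
       \<le> \<lfloor>real (h - i) * real_of_int a' / real_of_int b'\<rfloor>"

definition num_long :: "nat \<Rightarrow> int \<Rightarrow> int \<Rightarrow> int \<Rightarrow> int \<Rightarrow> int set \<Rightarrow> nat" where
  "num_long h a' b' m c \<Gamma> =
     card {(i, x). i < h \<and> x \<in> sumset i \<Gamma> \<and> \<not> short h a' b' m c i x}"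

end

theory Submission
  imports Defs
begin

text \<open>
  By collision-freeness the elements of \<open>S\<close> below \<open>c\<close> correspond bijectively to pairs \<open>(N, j)\<close> with \<open>N\<close>
  a multiset over \<open>\<Gamma>\<close> and \<open>j \<ge> 0\<close> such that \<open>\<Sum>N + j m < c\<close>, and the non-primitive elements of \<open>[c,c+m)\<close>
  to the multisets of size at most \<open>h\<close>.  Hence \<open>m - r = s\<close>, and \<open>k\<close> is the sum of \<open>\<lceil>(c - \<Sum>N)/m\<rceil>\<close> over
  the multisets of size less than \<open>h\<close>.  For \<open>|N| = i\<close> the slope bounds and the Farey property
  \<open>\<lfloor>j a'/b'\<rfloor> = \<lceil>j a/b\<rceil> - 1\<close> \<open>(1 \<le> j \<le> h)\<close> show that the summand is \<open>\<lfloor>(h - i) a'/b'\<rfloor>\<close>, plus 1 if \<open>\<Sum>N\<close> is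
  long, and that \<open>q = \<lfloor>h a'/b'\<rfloor>\<close>.  So \<open>E\<^sub>0 = T(\<lambda>j. \<lfloor>j a'/b'\<rfloor>)\<close> for the linear functional
  \<open>T(F) = \<ell> \<Sum>\<^sub>i F(h - i) s\<^sub>i - F(h) s\<close>.  As \<open>T(id) = 0\<close> and \<open>T(1) = (h - 1) s\<^sub>h\<close>, the four expressions
  come from four ways of writing \<open>\<lfloor>j a'/b'\<rfloor>\<close> modulo multiples of \<open>j\<close>; the last two count
  the integers up to \<open>(h - i) x\<close> and sum over \<open>i\<close> first.
\<close>


section \<open>Identities for multiset coefficients\<close>

lemma multichoose_Suc: "multichoose (Suc n) i = (n + i) choose i"
  by (simp add: multichoose_def)

text \<open>Hockey-stick identity: a multiset of size \<open>n\<close> over \<open>Suc g\<close>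
  letters is determined by its part avoiding one fixed letter. For \<open>g = 0\<close> truncated
  subtraction blocks the binomial form.\<close>

lemma sum_multichoose: "(\<Sum>i\<le>n. multichoose g i) = multichoose (Suc g) n"
proof (cases g)
  case 0
  have "multichoose 0 i = (if i = 0 then 1 else 0)" for i
    by (auto simp: multichoose_def)
  then show ?thesis by (simp add: 0 multichoose_Suc)
next
  case (Suc g')
  then show ?thesis using sum_choose_lower[of g' n] by (simp add: multichoose_Suc)
qed

lemma sum_multichoose_less:
  "0 < n \<Longrightarrow> (\<Sum>i<n. multichoose g i) = multichoose (Suc g) (n - 1)"
  using sum_multichoose[of g "n - 1"] by (cases n) (simp_all add: lessThan_Suc_atMost)

text \<open>Raising \<open>n\<close> by one raises every weight by one, and the added sum is a
  hockey stick.\<close>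

lemma sum_weighted_multichoose:
  "(\<Sum>i<n. (n - i) * multichoose g i) = (\<Sum>j<n. multichoose (Suc g) j)"
proof (induction n)
  case (Suc n)
  have "(\<Sum>i<Suc n. (Suc n - i) * multichoose g i)
      = (\<Sum>i<Suc n. (n - i) * multichoose g i + multichoose g i)"
    by (intro sum.cong) (auto simp: Suc_diff_le)
  also have "\<dots> = (\<Sum>i<n. (n - i) * multichoose g i) + (\<Sum>i\<le>n. multichoose g i)"
    by (simp add: sum.distrib lessThan_Suc_atMost[symmetric])
  also have "\<dots> = (\<Sum>j<Suc n. multichoose (Suc g) j)"
    using Suc by (simp add: sum_multichoose)
  finally show ?case .
qed simp

text \<open>By absorption both sides equal \<open>g + h\<close> times the binomial coefficient
  \<open>(g + h - 1) choose (h - 1)\<close>.\<close>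

lemma Suc_times_multichoose:
  assumes "0 < h"
  shows "Suc g * multichoose (Suc (Suc g)) (h - 1) = h * multichoose (Suc g) h"
proof -
  obtain k where k: "h = Suc k" using assms by (cases h) auto
  have "Suc k * ((g + Suc k) choose Suc k) = Suc (g + k) * ((g + k) choose k)"
    using Suc_times_binomial_eq[of "g + k" k] by (simp add: mult.commute)
  moreover have "Suc g * (Suc (g + k) choose k) = Suc (g + k) * ((g + k) choose k)"
    using binomial_absorb_comp[of "Suc (g + k)" k] by (simp add: Suc_diff_le)
  ultimately show ?thesis by (simp add: k multichoose_Suc)
qed

lemma multichoose_Suc_Suc:
  "multichoose (Suc g) (Suc k) = multichoose g (Suc k) + multichoose (Suc g) k"
  using sum_multichoose[of g "Suc k"] sum_multichoose[of g k] by simp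

lemma times_multichoose:
  assumes "0 < h"
  shows "g * multichoose (Suc g) (h - 1) = h * multichoose g h"
proof (cases g)
  case 0
  then show ?thesis using assms by (simp add: multichoose_def)
next
  case (Suc g')
  then show ?thesis using Suc_times_multichoose[OF assms, of g'] by simp
qed

section \<open>The linear functional behind \<open>E\<^sub>0\<close>\<close>

text \<open>The functional \<open>T\<close> of the overview for \<open>\<ell> = Suc g\<close>, where
  \<open>g\<close> will be the cardinality of \<open>\<Gamma>\<close>. For \<open>h > 0\<close> only
  the values of \<open>F\<close> at 1, ..., \<open>h\<close> enter.\<close>

definition eliahou_form :: "nat \<Rightarrow> nat \<Rightarrow> (nat \<Rightarrow> real) \<Rightarrow> real" where
  "eliahou_form g h F =
     real (Suc g) * (\<Sum>i<h. F (h - i) * real (multichoose g i)) - F h * real (multichoose (Suc g) h)"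

lemma eliahou_form_cong:
  assumes "0 < h" and "\<And>j. 1 \<le> j \<Longrightarrow> j \<le> h \<Longrightarrow> F j = F' j"
  shows "eliahou_form g h F = eliahou_form g h F'"
proof -
  have "(\<Sum>i<h. F (h - i) * real (multichoose g i)) = (\<Sum>i<h. F' (h - i) * real (multichoose g i))"
    using assms(2) by (intro sum.cong) auto
  then show ?thesis using assms by (simp add: eliahou_form_def)
qed

lemma eliahou_form_add:
  "eliahou_form g h (\<lambda>j. F j + F' j) = eliahou_form g h F + eliahou_form g h F'"
  by (simp add: eliahou_form_def algebra_simps sum.distrib)

lemma eliahou_form_scale:
  "eliahou_form g h (\<lambda>j. x * F j) = x * eliahou_form g h F"
  by (simp add: eliahou_form_def algebra_simps sum_distrib_left)

lemma eliahou_form_minus: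
  "eliahou_form g h (\<lambda>j. - F j) = - eliahou_form g h F"
  using eliahou_form_scale[of g h "-1" F] by simp

lemma eliahou_form_diff:
  "eliahou_form g h (\<lambda>j. F j - F' j) = eliahou_form g h F - eliahou_form g h F'"
  using eliahou_form_add[of g h F "\<lambda>j. - F' j"] by (simp add: eliahou_form_minus)

text \<open>Two hockey-stick summations turn the weighted sum into one coefficient, which absorption
  matches with the last term. Multiples of the identity may therefore be dropped from
  \<open>F\<close>.\<close>

lemma eliahou_form_real:
  assumes "0 < h"
  shows "eliahou_form g h real = 0"
proof -
  have "(\<Sum>i<h. real (h - i) * real (multichoose g i)) = real (\<Sum>i<h. (h - i) * multichoose g i)"
    by simp
  also have "(\<Sum>i<h. (h - i) * multichoose g i) = multichoose (Suc (Suc g)) (h - 1)"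
    using assms by (simp add: sum_weighted_multichoose sum_multichoose_less)
  finally have "eliahou_form g h real
      = real (Suc g * multichoose (Suc (Suc g)) (h - 1)) - real (h * multichoose (Suc g) h)"
    by (simp add: eliahou_form_def algebra_simps)
  then show ?thesis
    by (simp only: Suc_times_multichoose[OF assms])
qed

text \<open>One of the \<open>Suc g\<close> copies of \<open>multichoose (Suc g) (h - 1)\<close>
  cancels in Pascal's rule for \<open>multichoose (Suc g) h\<close>; the other \<open>g\<close>
  copies amount to \<open>h * multichoose g h\<close>.\<close>

lemma eliahou_form_one:
  assumes "0 < h"
  shows "eliahou_form g h (\<lambda>_. 1) = real (h - 1) * real (multichoose g h)"
proof -
  have "(\<Sum>i<h. real (multichoose g i)) = real (multichoose (Suc g) (h - 1))"
    using sum_multichoose_less[OF assms, of g] by (metis of_nat_sum)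
  then have "eliahou_form g h (\<lambda>_. 1)
      = real (Suc g * multichoose (Suc g) (h - 1)) - real (multichoose (Suc g) h)"
    by (simp add: eliahou_form_def algebra_simps)
  also have "Suc g * multichoose (Suc g) (h - 1) = multichoose (Suc g) (h - 1) + h * multichoose g h"
    using times_multichoose[OF assms, of g] by simp
  also have "multichoose (Suc g) h = multichoose g h + multichoose (Suc g) (h - 1)"
    using multichoose_Suc_Suc[of g "h - 1"] assms by simp
  finally show ?thesis using assms by (simp add: algebra_simps of_nat_diff)
qed

text \<open>Each floor counts the integers \<open>j \<ge> 1\<close> up to
  \<open>(h - i) * x\<close>. Summing over \<open>i\<close> first, the condition for fixed
  \<open>j\<close> becomes \<open>i \<le> h - \<lceil>j / x\<rceil>\<close>, so the inner sum is a
  hockey stick.\<close>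

lemma sum_floor_multichoose:
  fixes x :: real
  assumes "0 \<le> x"
  shows "(\<Sum>i<h. real_of_int \<lfloor>real (h - i) * x\<rfloor> * real (multichoose g i))
    = (\<Sum>j = 1..\<lfloor>real h * x\<rfloor>. real (multichoose (Suc g) (nat (int h - \<lceil>real_of_int j / x\<rceil>))))"
\<comment> \<open>At \<open>x = 0\<close> the floors vanish and the range of \<open>j\<close> is
  empty, so the default value of division by zero never enters.\<close>
proof (cases "x = 0")
  case False
  with assms have x: "0 < x" by simp
  let ?J = "{1..\<lfloor>real h * x\<rfloor>}"
  let ?P = "\<lambda>i j. real_of_int j \<le> real (h - i) * x"
  have fl: "real_of_int \<lfloor>real (h - i) * x\<rfloor> = (\<Sum>j\<in>?J. if ?P i j then 1 else 0)" for i
  proof -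
    have mono: "real (h - i) * x \<le> real h * x" using x by (intro mult_right_mono) auto
    have "{j \<in> ?J. ?P i j} = {1..\<lfloor>real (h - i) * x\<rfloor>}"
      using mono by (auto simp: le_floor_iff simp del: of_nat_diff)
    then have "real (card {j \<in> ?J. ?P i j}) = real_of_int \<lfloor>real (h - i) * x\<rfloor>"
      using x by simp
    moreover have "(\<Sum>j\<in>?J. if ?P i j then 1 else 0 :: real) = real (card {j \<in> ?J. ?P i j})"
      by (simp add: sum.If_cases Int_def)
    ultimately show ?thesis by simp
  qed
  have inner: "(\<Sum>i<h. (if ?P i j then 1 else 0) * real (multichoose g i))
      = real (multichoose (Suc g) (nat (int h - \<lceil>real_of_int j / x\<rceil>)))" if j: "j \<in> ?J" for j
  proof -
    let ?N = "nat (int h - \<lceil>real_of_int j / x\<rceil>)"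
    have iff: "?P i j \<longleftrightarrow> \<lceil>real_of_int j / x\<rceil> \<le> int (h - i)" for i
      using x by (simp add: ceiling_le_iff pos_divide_le_eq)
    \<comment> \<open>The lower bound makes \<open>i < h\<close> automatic for
      \<open>i \<le> ?N\<close>; the upper one keeps \<open>nat\<close> from truncating.\<close>
    have "1 \<le> \<lceil>real_of_int j / x\<rceil>" using j x by (simp add: le_ceiling_iff)
    moreover have "\<lceil>real_of_int j / x\<rceil> \<le> int h" using iff[of 0] j by (simp add: le_floor_iff)
    ultimately have "i < h \<and> ?P i j \<longleftrightarrow> i \<le> ?N" for i
      unfolding iff by linarith
    then have "{i. i < h \<and> ?P i j} = {..?N}" by auto
    moreover have "(\<Sum>i<h. (if ?P i j then 1 else 0) * real (multichoose g i))
        = (\<Sum>i | i < h \<and> ?P i j. real (multichoose g i))"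
      by (rule sum.mono_neutral_cong_right) auto
    ultimately show ?thesis by (simp flip: sum_multichoose)
  qed
  have "(\<Sum>i<h. real_of_int \<lfloor>real (h - i) * x\<rfloor> * real (multichoose g i))
      = (\<Sum>i<h. \<Sum>j\<in>?J. (if ?P i j then 1 else 0) * real (multichoose g i))"
    by (simp only: fl sum_distrib_right)
  also have "\<dots> = (\<Sum>j\<in>?J. \<Sum>i<h. (if ?P i j then 1 else 0) * real (multichoose g i))"
    by (rule sum.swap)
  also have "\<dots> = (\<Sum>j\<in>?J. real (multichoose (Suc g) (nat (int h - \<lceil>real_of_int j / x\<rceil>))))"
    by (intro sum.cong inner) auto
  finally show ?thesis .
qed simp

lemma eliahou_form_floor:
  fixes x :: real
  assumes "0 \<le> x"
  shows "eliahou_form g h (\<lambda>j. real_of_int \<lfloor>real j * x\<rfloor>)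
    = real (Suc g) * (\<Sum>j = 1..\<lfloor>real h * x\<rfloor>.
        real (multichoose (Suc g) (nat (int h - \<lceil>real_of_int j / x\<rceil>))))
      - real_of_int \<lfloor>real h * x\<rfloor> * real (multichoose (Suc g) h)"
  unfolding eliahou_form_def sum_floor_multichoose[OF assms] ..

lemma floor_mult_frac:
  fixes x :: real
  shows "\<lfloor>real j * x\<rfloor> = int j * \<lfloor>x\<rfloor> + \<lfloor>real j * frac x\<rfloor>"
proof -
  have "real j * x = real_of_int (int j * \<lfloor>x\<rfloor>) + real j * frac x"
    by (simp add: frac_def algebra_simps)
  then show ?thesis by (metis floor_add_int add.commute)
qed

text \<open>The integer part of \<open>x\<close> contributes a multiple of the identity, which the
  functional annihilates. The remaining argument is nonnegative, as the floor summation
  requires.\<close>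

lemma eliahou_form_floor_frac:
  fixes x :: real
  assumes "0 < h"
  shows "eliahou_form g h (\<lambda>j. real_of_int \<lfloor>real j * x\<rfloor>)
    = eliahou_form g h (\<lambda>j. real_of_int \<lfloor>real j * frac x\<rfloor>)"
proof -
  have "(\<lambda>j. real_of_int \<lfloor>real j * x\<rfloor>)
      = (\<lambda>j. of_int \<lfloor>x\<rfloor> * real j + of_int \<lfloor>real j * frac x\<rfloor>)"
    by (rule ext) (simp add: floor_mult_frac[of _ x])
  then show ?thesis
    using assms by (simp add: eliahou_form_add eliahou_form_scale eliahou_form_real)
qed

section \<open>Farey predecessors\<close>

text \<open>No fraction with denominator \<open>j \<le> h\<close> lies strictly between
  \<open>a'/b'\<close> and \<open>a/b\<close>, so the largest integer strictly below
  \<open>j a/b\<close> is already at most \<open>j a'/b'\<close>.\<close>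

lemma farey_predecessor_floor:
  assumes pred: "farey_predecessor h a b a' b'" and j: "1 \<le> j" "j \<le> h"
  shows "\<lfloor>real j * of_int a' / of_int b'\<rfloor> = \<lceil>real j * of_int a / of_int b\<rceil> - 1"
proof (rule antisym)
  have lt: "real_of_int a' / of_int b' < of_int a / of_int b"
    using pred by (simp add: farey_predecessor_def)
  have "real j * (of_int a' / of_int b') < real j * (of_int a / of_int b)"
    using lt j by (intro mult_strict_left_mono) auto
  then show "\<lfloor>real j * of_int a' / of_int b'\<rfloor> \<le> \<lceil>real j * of_int a / of_int b\<rceil> - 1"
    by (simp add: floor_le_iff) linarith
next
  \<comment> \<open>Cancelling the gcd of \<open>n\<close> and \<open>j\<close> turns
    \<open>n / j\<close>, which is below \<open>a/b\<close>, into an \<open>h\<close>-Farey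
    fraction, to which the maximality of the predecessor applies.\<close>
  define n where "n = \<lceil>real j * of_int a / of_int b\<rceil> - 1"
  define d where "d = gcd n (int j)"
  have d: "0 < d" using j by (simp add: d_def)
  obtain x y where xy: "n = x * d" "int j = y * d" "coprime x y"
    using gcd_coprime_exists[of n "int j"] d unfolding d_def by fastforce
  have y: "1 \<le> y"
  proof -
    have "0 < y * d" using xy(2) j by linarith
    then show ?thesis using d by (simp add: zero_less_mult_iff)
  qed
  have "y * 1 \<le> y * d" using d y by (intro mult_left_mono) auto
  then have "y \<le> int h" using xy(2) j by simp
  then have farey: "farey h x y" using xy y by (simp add: farey_def)
  have j': "real j = of_int y * of_int d" using xy(2) by (metis of_int_mult of_int_of_nat_eq)
  have xy_eq: "real_of_int x / of_int y = of_int n / real j"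
    using d y by (simp add: j' xy(1))
  have "real_of_int n < real j * of_int a / of_int b"
    unfolding n_def by linarith
  then have "real_of_int n / real j < of_int a / of_int b"
    using j by (simp add: pos_divide_less_eq mult.commute)
  then have "real_of_int n / real j \<le> of_int a' / of_int b'"
    using pred farey unfolding farey_predecessor_def xy_eq[symmetric] by blast
  then have "real_of_int n \<le> real j * of_int a' / of_int b'"
    using j by (simp add: pos_divide_le_eq mult.commute)
  then show "\<lceil>real j * of_int a / of_int b\<rceil> - 1 \<le> \<lfloor>real j * of_int a' / of_int b'\<rfloor>"
    by (simp add: le_floor_iff n_def)
qed


section \<open>Multisets of generators in a collision-free semigroup\<close>

lemma sumset_eq_image:
  "sumset i A = sum_mset ` multisets_of_size A i"
proof (intro equalityI subsetI)
  fix x assume "x \<in> sumset i A"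
  then obtain xs where "x = sum_list xs" "length xs = i" "set xs \<subseteq> A"
    by (auto simp: sumset_def)
  then show "x \<in> sum_mset ` multisets_of_size A i"
    by (intro image_eqI[of _ _ "mset xs"]) (auto simp: sum_mset_sum_list multisets_of_size_def)
next
  fix x assume "x \<in> sum_mset ` multisets_of_size A i"
  then obtain M where M: "x = \<Sum>\<^sub># M" "set_mset M \<subseteq> A" "size M = i"
    by (auto simp: multisets_of_size_def)
  obtain xs where "mset xs = M" using ex_mset by blast
  then show "x \<in> sumset i A"
    using M by (auto simp: sumset_def sum_mset_sum_list intro!: exI[of _ xs])
qed

text \<open>\<open>lower\<close> and \<open>upper\<close> put \<open>h\<Gamma>\<close> into
  \<open>[c, c + m)\<close> element by element, which stays meaningful for empty
  \<open>\<Gamma>\<close>. The Farey data are fixed only in a later context.\<close>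

locale collision_free_semigroup =
  fixes h :: nat and m c :: int and \<Gamma> :: "int set"
  assumes h: "2 \<le> h" and m: "0 < m" and mc: "m < c" and fin: "finite \<Gamma>"
    and gt_m: "\<And>x. x \<in> \<Gamma> \<Longrightarrow> m < x"
    and lower: "\<And>x. x \<in> \<Gamma> \<Longrightarrow> c \<le> int h * x"
    and upper: "\<And>x. x \<in> \<Gamma> \<Longrightarrow> int h * x < c + m"
    and canon: "canonically_defined m \<Gamma> c"
    and cfree: "collision_free m c (semigroup_gen m \<Gamma> c)"
begin

abbreviation S :: "int set" where "S \<equiv> semigroup_gen m \<Gamma> c"

abbreviation small :: "int multiset set" where
  "small \<equiv> {N. set_mset N \<subseteq> \<Gamma> \<and> size N < h}"

text \<open>For \<open>x \<le> c\<close> this is the number of \<open>j \<ge> 0\<close> with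
  \<open>x + j * m < c\<close>.\<close>

definition steps :: "int \<Rightarrow> int" where
  "steps x = \<lceil>of_int (c - x) / real_of_int m\<rceil>"

lemma m_notin: "m \<notin> \<Gamma>"
  using gt_m by blast

lemma less_c: "x \<in> \<Gamma> \<Longrightarrow> x < c"
proof -
  assume x: "x \<in> \<Gamma>"
  have "2 * x \<le> int h * x" using h gt_m[OF x] m by (intro mult_right_mono) auto
  then show "x < c" using upper[OF x] mc by linarith
qed

lemma m_primitive: "m \<in> primitives S" and Gamma_primitive: "\<Gamma> \<subseteq> primitives S"
  using canon by (auto simp: canonically_defined_def)

lemma less_steps_iff: "j < steps x \<longleftrightarrow> x + j * m < c"
  using m by (simp add: steps_def less_ceiling_iff pos_less_divide_eq flip: of_int_mult of_int_diff)
    linarith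

lemma S_zero_or_ge: "x \<in> S \<Longrightarrow> x = 0 \<or> m \<le> x"
  unfolding semigroup_gen_def
proof (induction rule: submonoid_gen.induct)
  case (gen x)
  then show ?case using gt_m mc by fastforce
qed (use m in auto)

lemma S_zero: "0 \<in> S" and S_m: "m \<in> S" and S_ge: "c \<le> x \<Longrightarrow> x \<in> S"
  and S_Gamma: "x \<in> \<Gamma> \<Longrightarrow> x \<in> S" and S_add: "x \<in> S \<Longrightarrow> y \<in> S \<Longrightarrow> x + y \<in> S"
  unfolding semigroup_gen_def by (auto intro: submonoid_gen.intros)

lemma rep_in_S: "set_mset N \<subseteq> \<Gamma> \<Longrightarrow> \<Sum>\<^sub># N + int j * m \<in> S"
proof (induction N)
  case empty
  then show ?case
    by (induction j) (auto simp: S_zero algebra_simps intro: S_add[OF S_m])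
next
  case (add x N)
  then show ?case using S_add[OF S_Gamma[of x], of "\<Sum>\<^sub># N + int j * m"] by (simp add: add.assoc)
qed

text \<open>Elements of \<open>S\<close> are nonnegative, so the summands of an element below
  \<open>c\<close> are below \<open>c\<close> too, and a generator from \<open>{c..}\<close> never
  occurs.\<close>

lemma rep_of_S:
  "x \<in> S \<Longrightarrow> x < c \<Longrightarrow> \<exists>N j. set_mset N \<subseteq> \<Gamma> \<and> x = \<Sum>\<^sub># N + int j * m"
  unfolding semigroup_gen_def
proof (induction rule: submonoid_gen.induct)
  case zero
  show ?case by (rule exI[of _ "{#}"], rule exI[of _ 0]) simp
next
  case (gen x)
  then consider "x = m" | "x \<in> \<Gamma>" by auto
  then show ?case
  proof cases
    case 1
    then show ?thesis by (intro exI[of _ "{#}"] exI[of _ 1]) simp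
  next
    case 2
    then show ?thesis by (intro exI[of _ "{#x#}"] exI[of _ 0]) simp
  qed
next
  case (add x y)
  have "x \<in> S" "y \<in> S" using add by (simp_all add: semigroup_gen_def)
  then have "0 \<le> x" "0 \<le> y" using S_zero_or_ge m by force+
  then have "x < c" "y < c" using add.prems by linarith+
  then obtain N j N' j' where "set_mset N \<subseteq> \<Gamma>" "x = \<Sum>\<^sub># N + int j * m"
    "set_mset N' \<subseteq> \<Gamma>" "y = \<Sum>\<^sub># N' + int j' * m"
    using add.IH by blast
  then show ?case by (intro exI[of _ "N + N'"] exI[of _ "j + j'"]) (auto simp: algebra_simps)
qed

lemma sum_lower: "set_mset N \<subseteq> \<Gamma> \<Longrightarrow> int (size N) * c \<le> int h * \<Sum>\<^sub># N"
proof (induction N)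
  case (add x N)
  then show ?case using lower[of x] by (simp add: algebra_simps)
qed simp

text \<open>Integrality sharpens \<open>upper\<close> to \<open>int h * x \<le> c + m - 1\<close>, a
  non-strict bound that adds up even over the empty multiset and for size at most \<open>h\<close>
  still gives a sum below \<open>c + m\<close>.\<close>

lemma sum_upper: "set_mset N \<subseteq> \<Gamma> \<Longrightarrow> int h * \<Sum>\<^sub># N \<le> int (size N) * (c + m - 1)"
proof (induction N)
  case (add x N)
  then have "int h * x \<le> c + m - 1" "int h * \<Sum>\<^sub># N \<le> int (size N) * (c + m - 1)"
    using upper[of x] by auto
  then have "int h * x + int h * \<Sum>\<^sub># N \<le> (c + m - 1) + int (size N) * (c + m - 1)" by linarith
  then show ?case by (simp add: distrib_left distrib_right)
qed simp

lemma sum_less: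
  assumes "set_mset N \<subseteq> \<Gamma>" "size N \<le> h"
  shows "\<Sum>\<^sub># N < c + m"
proof -
  have "int h * \<Sum>\<^sub># N \<le> int (size N) * (c + m - 1)" by (rule sum_upper[OF assms(1)])
  also have "\<dots> \<le> int h * (c + m - 1)" using assms(2) m mc by (intro mult_right_mono) auto
  finally have "\<Sum>\<^sub># N \<le> c + m - 1" using h by simp
  then show ?thesis by simp
qed

lemma sum_less_c:
  assumes N: "N \<in> small"
  shows "\<Sum>\<^sub># N < c"
proof (cases "\<Gamma> = {}")
  case True
  then show ?thesis using N m mc by simp
next
  case False
  then obtain x where x: "x \<in> \<Gamma>" by blast
  \<comment> \<open>Padding \<open>N\<close> with \<open>k \<ge> 1\<close> copies of
    \<open>x\<close> gives size \<open>h\<close>, hence a sum below \<open>c + m\<close>, and the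
    padding alone exceeds \<open>m\<close>.\<close>
  define k where "k = h - size N"
  have k: "0 < k" "size N + k = h" using N by (auto simp: k_def)
  have "\<Sum>\<^sub># (N + replicate_mset k x) < c + m"
    using N x k by (intro sum_less) (auto split: if_splits)
  moreover have "1 * x \<le> int k * x" using k gt_m[OF x] m by (intro mult_right_mono) auto
  ultimately show ?thesis using gt_m[OF x] by simp
qed

lemma sum_ge_c:
  assumes "set_mset N \<subseteq> \<Gamma>" "h \<le> size N"
  shows "c \<le> \<Sum>\<^sub># N"
proof -
  have "int h * c \<le> int (size N) * c" using assms(2) m mc by (intro mult_right_mono) auto
  also have "\<dots> \<le> int h * \<Sum>\<^sub># N" by (rule sum_lower[OF assms(1)])
  finally show ?thesis using h by simp
qed

lemma sum_less_iff:
  assumes N: "set_mset N \<subseteq> \<Gamma>"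
  shows "\<Sum>\<^sub># N < c \<longleftrightarrow> size N < h" and "\<Sum>\<^sub># N < c + m \<longleftrightarrow> size N \<le> h"
proof -
  show "\<Sum>\<^sub># N < c \<longleftrightarrow> size N < h"
    using sum_less_c[of N] sum_ge_c[OF N] N by fastforce
  \<comment> \<open>Remove one element: at least \<open>h\<close> remain and sum to at least
    \<open>c\<close>, while the removed one exceeds \<open>m\<close>.\<close>
  have "c + m \<le> \<Sum>\<^sub># N" if "h < size N"
  proof -
    obtain x N' where N': "N = add_mset x N'"
      using \<open>h < size N\<close> by (cases N) auto
    have "c \<le> \<Sum>\<^sub># N'" using that N N' by (intro sum_ge_c) auto
    then show ?thesis using gt_m[of x] N N' by simp
  qed
  then show "\<Sum>\<^sub># N < c + m \<longleftrightarrow> size N \<le> h"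
    using sum_less[OF N] by fastforce
qed

lemma combination_unique:
  assumes "set_mset M \<subseteq> primitives S" "set_mset M' \<subseteq> primitives S"
    and "\<Sum>\<^sub># M = \<Sum>\<^sub># M'" "c \<le> \<Sum>\<^sub># M" "\<Sum>\<^sub># M < c + m"
  shows "M = M'"
proof -
  have "\<exists>!K. set_mset K \<subseteq> primitives S \<and> \<Sum>\<^sub># K = \<Sum>\<^sub># M"
    using cfree assms(4,5) by (simp add: collision_free_def)
  then show ?thesis using assms(1-3) by metis
qed

lemma exists_shift:
  assumes "x < c + m"
  shows "\<exists>t::nat. c \<le> x + int t * m \<and> x + int t * m < c + m"
proof (intro exI conjI)
  let ?t = "nat (steps x)"
  have nonneg: "0 \<le> steps x" using less_steps_iff[of "-1" x] assms by simp
  then show "c \<le> x + int ?t * m" using less_steps_iff[of "steps x" x] by simp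
  show "x + int ?t * m < c + m"
    using less_steps_iff[of "steps x - 1" x] nonneg by (simp add: algebra_simps)
qed

lemma rep_primitives:
  "set_mset N \<subseteq> \<Gamma> \<Longrightarrow> set_mset (N + replicate_mset j m) \<subseteq> primitives S"
  using Gamma_primitive m_primitive by (auto split: if_splits)

text \<open>Uniqueness is assumed only in \<open>[c, c + m)\<close>, so the same number of copies of
  \<open>m\<close> is added to both representations to shift their value there. Since
  \<open>m\<close> is not in \<open>\<Gamma>\<close>, filtering out \<open>m\<close> recovers the
  multiset and counting \<open>m\<close> the multiplicity.\<close>

lemma rep_unique:
  assumes N: "set_mset N \<subseteq> \<Gamma>" and N': "set_mset N' \<subseteq> \<Gamma>"
    and eq: "\<Sum>\<^sub># N + int j * m = \<Sum>\<^sub># N' + int j' * m" and lt: "\<Sum>\<^sub># N + int j * m < c + m"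
  shows "N = N' \<and> j = j'"
proof -
  obtain t where t: "c \<le> \<Sum>\<^sub># N + int j * m + int t * m" "\<Sum>\<^sub># N + int j * m + int t * m < c + m"
    using exists_shift[OF lt] by blast
  have *: "N + replicate_mset (j + t) m = N' + replicate_mset (j' + t) m"
    using t eq
    by (intro combination_unique rep_primitives N N') (simp_all add: algebra_simps)
  have "filter_mset (\<lambda>x. x \<noteq> m) K = K" if "set_mset K \<subseteq> \<Gamma>" for K
    using that m_notin by (intro filter_mset_cong0[of K _ "\<lambda>_. True", simplified]) auto
  moreover have "count K m = 0" if "set_mset K \<subseteq> \<Gamma>" for K
    using that m_notin by (auto simp: count_eq_zero_iff)
  ultimately show ?thesis
    using arg_cong[OF *, of "filter_mset (\<lambda>x. x \<noteq> m)"] arg_cong[OF *, of "\<lambda>K. count K m"] N N'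
    by simp
qed

lemma sum_inj: "inj_on sum_mset {N. set_mset N \<subseteq> \<Gamma> \<and> size N \<le> h}"
  using rep_unique[where j = 0 and j' = 0] sum_less by (auto intro!: inj_onI)

lemma finite_multisets: "finite {N. set_mset N \<subseteq> \<Gamma> \<and> size N \<le> n}"
proof -
  have "{N. set_mset N \<subseteq> \<Gamma> \<and> size N \<le> n} = (\<Union>i\<le>n. multisets_of_size \<Gamma> i)"
    by (auto simp: multisets_of_size_def)
  then show ?thesis using fin by auto
qed

lemma finite_small: "finite small"
  by (rule finite_subset[OF _ finite_multisets[of h]]) auto

section \<open>Counting left elements, generators and long elements\<close>

lemma num_left_elements_eq:
  "int (num_left_elements S c) = (\<Sum>N\<in>small. steps (\<Sum>\<^sub># N))"
proof -
  let ?D = "SIGMA N:small. {..<nat (steps (\<Sum>\<^sub># N))}"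
  let ?f = "\<lambda>(N, j). \<Sum>\<^sub># N + int j * m"
  have lt: "j < nat (steps (\<Sum>\<^sub># N)) \<longleftrightarrow> \<Sum>\<^sub># N + int j * m < c" for N j
    using less_steps_iff[of "int j" "\<Sum>\<^sub># N"] by (simp add: zless_nat_eq_int_zless)
  have inj: "inj_on ?f ?D"
  proof (rule inj_onI)
    fix p p' assume p: "p \<in> ?D" "p' \<in> ?D" "?f p = ?f p'"
    obtain N j N' j' where pp: "p = (N, j)" "p' = (N', j')" by (metis surj_pair)
    have "N = N' \<and> j = j'" using p m by (intro rep_unique) (auto simp: pp lt)
    then show "p = p'" by (simp add: pp)
  qed
  have image: "?f ` ?D = S \<inter> {0..<c}"
  proof (intro equalityI subsetI)
    fix x assume "x \<in> ?f ` ?D"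
    then show "x \<in> S \<inter> {0..<c}"
    proof
      fix p assume "x = ?f p" "p \<in> ?D"
      then obtain N j where "set_mset N \<subseteq> \<Gamma>" "x = \<Sum>\<^sub># N + int j * m" "x < c"
        by (cases p) (auto simp: lt)
      then show ?thesis using rep_in_S[of N j] S_zero_or_ge[of x] m by auto
    qed
  next
    fix x assume x: "x \<in> S \<inter> {0..<c}"
    then obtain N j where Nj: "set_mset N \<subseteq> \<Gamma>" "x = \<Sum>\<^sub># N + int j * m"
      using rep_of_S[of x] by auto
    \<comment> \<open>Dropping the copies of \<open>m\<close> keeps the value below
      \<open>c\<close>, which forces the size of \<open>N\<close> below \<open>h\<close>.\<close>
    have "0 \<le> int j * m" using m by simp
    then have "\<Sum>\<^sub># N < c" using x Nj by auto
    then have "size N < h" using sum_less_iff(1) Nj by blast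
    then show "x \<in> ?f ` ?D" using Nj x by (intro image_eqI[of _ _ "(N, j)"]) (auto simp: lt)
  qed
  have "num_left_elements S c = card ?D"
    using card_image[OF inj] unfolding num_left_elements_def image .
  also have "\<dots> = (\<Sum>N\<in>small. nat (steps (\<Sum>\<^sub># N)))"
    using finite_small by simp
  finally have "int (num_left_elements S c) = (\<Sum>N\<in>small. int (nat (steps (\<Sum>\<^sub># N))))" by simp
  also have "\<dots> = (\<Sum>N\<in>small. steps (\<Sum>\<^sub># N))"
  proof (intro sum.cong refl)
    fix N assume "N \<in> small"
    then have "0 < steps (\<Sum>\<^sub># N)" using sum_less_c less_steps_iff[of 0] by simp
    then show "int (nat (steps (\<Sum>\<^sub># N))) = steps (\<Sum>\<^sub># N)" by simp
  qed
  finally show ?thesis .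
qed

text \<open>Canonical definedness supplies one inclusion. For the other, peel a generator off a
  representation of a primitive \<open>x\<close>: the rest must be 0, so \<open>x\<close> is that
  generator.\<close>

lemma num_left_generators_eq: "num_left_generators S c = Suc (card \<Gamma>)"
proof -
  have "{x \<in> primitives S. x < c} = insert m \<Gamma>"
  proof (intro equalityI subsetI)
    fix x assume "x \<in> {x \<in> primitives S. x < c}"
    then have x: "x \<in> S" "0 < x" "x < c"
      and prim: "\<And>y z. y \<in> S \<Longrightarrow> z \<in> S \<Longrightarrow> x = y + z \<Longrightarrow> y = 0 \<or> z = 0"
      by (auto simp: primitives_def)
    obtain N j where Nj: "set_mset N \<subseteq> \<Gamma>" "x = \<Sum>\<^sub># N + int j * m"
      using rep_of_S x by blast
    show "x \<in> insert m \<Gamma>"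
    proof (cases N)
      case empty
      then obtain j' where "j = Suc j'" using Nj x by (cases j) auto
      then have "x = m + (\<Sum>\<^sub># {#} + int j' * m)" using Nj empty by (simp add: algebra_simps)
      then show ?thesis using prim[OF S_m rep_in_S[of "{#}" j']] m by auto
    next
      case (add y N')
      then have "x = y + (\<Sum>\<^sub># N' + int j * m)" "y \<in> \<Gamma>" "set_mset N' \<subseteq> \<Gamma>" using Nj by auto
      then show ?thesis using prim[OF S_Gamma rep_in_S, of y N' j] gt_m[of y] m by auto
    qed
  qed (use m_primitive Gamma_primitive mc less_c in auto)
  then show ?thesis
    using fin m_notin by (simp add: num_left_generators_def)
qed

text \<open>Each multiset over \<open>\<Gamma>\<close> of size at most \<open>h\<close> is shifted
  by copies of \<open>m\<close> into \<open>[c, c + m)\<close>. The values obtained are exactly the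
  non-primitive elements of this window, and no primitive element lies beyond it.\<close>

lemma num_right_generators_eq:
  "int (num_right_generators S c) = m - int (card {N. set_mset N \<subseteq> \<Gamma> \<and> size N \<le> h})"
proof -
  let ?A = "{N. set_mset N \<subseteq> \<Gamma> \<and> size N \<le> h}"
  let ?R = "{x \<in> primitives S. c \<le> x}"
  have "\<forall>N\<in>?A. \<exists>t. c \<le> \<Sum>\<^sub># N + int t * m \<and> \<Sum>\<^sub># N + int t * m < c + m"
    using exists_shift sum_less by auto
  then have "\<exists>T. \<forall>N\<in>?A. c \<le> \<Sum>\<^sub># N + int (T N) * m \<and> \<Sum>\<^sub># N + int (T N) * m < c + m"
    by (rule bchoice)
  then obtain T where T: "\<And>N. N \<in> ?A \<Longrightarrow> c \<le> \<Sum>\<^sub># N + int (T N) * m"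
    "\<And>N. N \<in> ?A \<Longrightarrow> \<Sum>\<^sub># N + int (T N) * m < c + m"
    by blast
  let ?f = "\<lambda>N. \<Sum>\<^sub># N + int (T N) * m"
  have inj: "inj_on ?f ?A"
    using rep_unique T(2) by (intro inj_onI) blast
  have R: "?R \<subseteq> {c..<c + m}"
  proof
    fix x assume "x \<in> ?R"
    then have x: "c \<le> x" and prim: "\<And>y z. y \<in> S \<Longrightarrow> z \<in> S \<Longrightarrow> x = y + z \<Longrightarrow> y = 0 \<or> z = 0"
      by (auto simp: primitives_def)
    have "x < c + m"
    proof (rule ccontr)
      assume "\<not> x < c + m"
      then show False using prim[OF S_m S_ge[of "x - m"]] m mc by auto
    qed
    then show "x \<in> {c..<c + m}" using x by simp
  qed
  \<comment> \<open>A primitive \<open>?f N\<close> would also have the combination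
    \<open>{#?f N#}\<close>; by uniqueness it would be \<open>m\<close> or an element of
    \<open>\<Gamma>\<close>, all of which are below \<open>c\<close>.\<close>
  have not_R: "?f N \<notin> ?R" if N: "N \<in> ?A" for N
  proof
    assume "?f N \<in> ?R"
    then have "{#?f N#} = N + replicate_mset (T N) m"
      using T[OF N] N rep_primitives[of N "T N"] by (intro combination_unique) auto
    then have "?f N \<in> set_mset (N + replicate_mset (T N) m)"
      by (metis union_single_eq_member add.right_neutral add_mset_add_single)
    then have "?f N = m \<or> ?f N \<in> \<Gamma>" using N by (auto split: if_splits)
    then show False using T(1)[OF N] mc less_c by force
  qed
  have surj: "x \<in> ?f ` ?A" if x: "x \<in> {c..<c + m}" "x \<notin> ?R" for x
  proof -
    have "x \<in> S" "0 < x" using x S_ge m mc by auto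
    then obtain y z where yz: "y \<in> S" "z \<in> S" "y \<noteq> 0" "z \<noteq> 0" "x = y + z"
      using x by (auto simp: primitives_def)
    \<comment> \<open>Nonzero elements of \<open>S\<close> are at least \<open>m\<close>, so neither
      summand can reach \<open>c\<close>, and both have representations.\<close>
    then have "y < c" "z < c" using S_zero_or_ge[of y] S_zero_or_ge[of z] x by auto
    then obtain N j N' j' where N: "set_mset N \<subseteq> \<Gamma>" "y = \<Sum>\<^sub># N + int j * m"
      and N': "set_mset N' \<subseteq> \<Gamma>" "z = \<Sum>\<^sub># N' + int j' * m"
      using rep_of_S yz by meson
    let ?N = "N + N'" and ?j = "j + j'"
    have x_eq: "x = \<Sum>\<^sub># ?N + int ?j * m" using yz N N' by (simp add: algebra_simps)
    moreover have "0 \<le> int ?j * m" using m by simp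
    ultimately have "\<Sum>\<^sub># ?N < c + m"
      using x(1) unfolding atLeastLessThan_iff by linarith
    moreover have sub: "set_mset ?N \<subseteq> \<Gamma>" using N N' by simp
    ultimately have A: "?N \<in> ?A" using sum_less_iff(2) by blast
    \<comment> \<open>Both shifts of \<open>?N\<close> lie in a half-open window of length
      \<open>m\<close>, so they coincide.\<close>
    have "?j = T ?N"
    proof (rule ccontr)
      assume "?j \<noteq> T ?N"
      then have "1 \<le> \<bar>int ?j - int (T ?N)\<bar>" by linarith
      then have "1 * m \<le> \<bar>int ?j - int (T ?N)\<bar> * m" using m by (intro mult_right_mono) auto
      also have "\<dots> = \<bar>(int ?j - int (T ?N)) * m\<bar>" using m by (simp add: abs_mult)
      also have "(int ?j - int (T ?N)) * m = x - ?f ?N" by (simp add: x_eq algebra_simps)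
      finally show False using x T[OF A] by auto
    qed
    then show ?thesis using x_eq A by (intro image_eqI[of _ _ ?N]) auto
  qed
  have image: "?f ` ?A = {c..<c + m} - ?R"
  proof (rule antisym)
    show "?f ` ?A \<subseteq> {c..<c + m} - ?R"
    proof (rule image_subsetI)
      fix N assume "N \<in> ?A"
      then show "?f N \<in> {c..<c + m} - ?R" using not_R[of N] T[of N] by simp
    qed
    show "{c..<c + m} - ?R \<subseteq> ?f ` ?A"
      using surj by (intro subsetI) (elim DiffE)
  qed
  have "card ?A = card ({c..<c + m} - ?R)" using card_image[OF inj] image by simp
  also have "\<dots> = nat m - card ?R" using R by (simp add: card_Diff_subset finite_subset)
  finally have "card ?A = nat m - card ?R" .
  \<comment> \<open>This rules out truncation in the preceding difference of naturals.\<close>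
  moreover have "card ?R \<le> nat m" using card_mono[OF _ R] by simp
  ultimately show ?thesis unfolding num_right_generators_def using m by simp
qed

lemma card_multisets_le:
  "card {N. set_mset N \<subseteq> \<Gamma> \<and> size N \<le> h} = multichoose (Suc (card \<Gamma>)) h"
proof -
  have "{N. set_mset N \<subseteq> \<Gamma> \<and> size N \<le> h} = (\<Union>i\<le>h. multisets_of_size \<Gamma> i)"
    by (auto simp: multisets_of_size_def)
  also have "card \<dots> = (\<Sum>i\<le>h. card (multisets_of_size \<Gamma> i))"
    using fin by (intro card_UN_disjoint ballI impI finite_multisets_of_size)
      (auto simp: multisets_of_size_def)
  also have "\<dots> = (\<Sum>i\<le>h. multichoose (card \<Gamma>) i)"
    using fin by (simp add: card_multisets_of_size[folded multichoose_def])
  finally show ?thesis by (simp add: sum_multichoose)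
qed

lemma sum_small: "(\<Sum>N\<in>small. F (size N)) = (\<Sum>i<h. int (multichoose (card \<Gamma>) i) * F i)"
proof -
  have "small = (\<Union>i<h. multisets_of_size \<Gamma> i)"
    by (auto simp: multisets_of_size_def)
  then have "(\<Sum>N\<in>small. F (size N)) = (\<Sum>i<h. \<Sum>N\<in>multisets_of_size \<Gamma> i. F (size N))"
    using fin
    by (simp only:)
      (intro sum.UNION_disjoint ballI impI finite_multisets_of_size;
        auto simp: multisets_of_size_def)
  also have "\<dots> = (\<Sum>i<h. \<Sum>N\<in>multisets_of_size \<Gamma> i. F i)"
    by (intro sum.cong) (auto simp: multisets_of_size_def)
  finally show ?thesis using fin by (simp add: card_multisets_of_size[folded multichoose_def])
qed

text \<open>By collision-freeness distinct multisets in \<open>small\<close> have distinct sums, so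
  each long pair stands for exactly one multiset.\<close>

lemma num_long_eq:
  "num_long h a' b' m c \<Gamma> = card {N \<in> small. \<not> short h a' b' m c (size N) (\<Sum>\<^sub># N)}"
proof -
  let ?L = "{N \<in> small. \<not> short h a' b' m c (size N) (\<Sum>\<^sub># N)}"
  let ?f = "\<lambda>N :: int multiset. (size N, \<Sum>\<^sub># N)"
  have inj: "inj_on ?f ?L"
    by (rule inj_onI) (auto intro: inj_onD[OF sum_inj])
  have image: "?f ` ?L = {(i, x). i < h \<and> x \<in> sumset i \<Gamma> \<and> \<not> short h a' b' m c i x}"
    by (auto simp: sumset_eq_image multisets_of_size_def)
  show ?thesis
    using card_image[OF inj] unfolding num_long_def image .
qed

section \<open>Slope bounds and the Eliahou number\<close>

context
  fixes a b a' b' :: int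
  assumes pred: "farey_predecessor h a b a' b'"
    and slope_lower: "real_of_int a' / of_int b' < of_int (c + m) / (real h * of_int m)"
    and slope_upper: "of_int (c + m) / (real h * of_int m) \<le> real_of_int a / of_int b"
begin

abbreviation slope_floor :: "nat \<Rightarrow> int" where
  "slope_floor j \<equiv> \<lfloor>real j * of_int a' / of_int b'\<rfloor>"

text \<open>The slope \<open>(c + m)/(h m)\<close> lies above \<open>a'/b'\<close> and not above
  \<open>a/b\<close>, and the Farey property makes \<open>slope_floor j + 1\<close> the ceiling of
  \<open>j a/b\<close>. Clearing denominators leaves integer inequalities.\<close>

lemma slope_floor_bounds:
  assumes j: "1 \<le> j" "j \<le> h"
  shows "slope_floor j * (int h * m) < int j * (c + m)"
    and "int j * (c + m) \<le> (slope_floor j + 1) * (int h * m)"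
proof -
  have hm: "0 < real h * of_int m" using h m by simp
  have "real_of_int (slope_floor j) \<le> real j * (of_int a' / of_int b')" by simp
  also have "\<dots> < real j * (of_int (c + m) / (real h * of_int m))"
    using slope_lower j by (intro mult_strict_left_mono) auto
  finally have "real_of_int (slope_floor j) * (real h * of_int m) < real j * of_int (c + m)"
    using hm by (simp add: pos_less_divide_eq)
  then have "real_of_int (slope_floor j * (int h * m)) < real_of_int (int j * (c + m))" by simp
  then show "slope_floor j * (int h * m) < int j * (c + m)" by (simp only: of_int_less_iff)
  have "real j * (of_int (c + m) / (real h * of_int m)) \<le> real j * (of_int a / of_int b)"
    using slope_upper by (intro mult_left_mono) auto
  also have "\<dots> \<le> real_of_int (slope_floor j + 1)"
    unfolding farey_predecessor_floor[OF pred j] by simp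
  finally have "real j * of_int (c + m) \<le> real_of_int (slope_floor j + 1) * (real h * of_int m)"
    using hm by (simp add: pos_divide_le_eq)
  then have "real_of_int (int j * (c + m)) \<le> real_of_int ((slope_floor j + 1) * (int h * m))" by simp
  then show "int j * (c + m) \<le> (slope_floor j + 1) * (int h * m)" by (simp only: of_int_le_iff)
qed

text \<open>\<open>sum_upper\<close> and \<open>sum_lower\<close>, combined with the slope bounds
  for \<open>k = h - size N\<close>, leave only two consecutive values; \<open>short\<close> decides
  between them.\<close>

lemma steps_eq:
  assumes N: "N \<in> small"
  shows "steps (\<Sum>\<^sub># N) = slope_floor (h - size N)
    + (if short h a' b' m c (size N) (\<Sum>\<^sub># N) then 0 else 1)"
proof -
  define k where "k = h - size N"
  let ?f = "slope_floor k" and ?x = "\<Sum>\<^sub># N"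
  have k: "1 \<le> k" "k \<le> h" "int h = int (size N) + int k" using N by (auto simp: k_def)
  have sub: "set_mset N \<subseteq> \<Gamma>" using N by simp
  note bounds = slope_floor_bounds[OF k(1,2)]
  \<comment> \<open>Since \<open>size N + k = h\<close>, the two bounds add up to
    \<open>int h * (c + m)\<close>; lowering the index to \<open>?f - 1\<close> removes the excess
    \<open>int h * m\<close>.\<close>
  have "int h * (?x + (?f - 1) * m) < int h * c"
  proof -
    have "int (size N) * (c + m - 1) \<le> int (size N) * (c + m)" by (intro mult_left_mono) auto
    then have "int h * ?x \<le> int (size N) * (c + m)" using sum_upper[OF sub] by linarith
    then have "int h * (?x + (?f - 1) * m) < (int (size N) + int k) * (c + m) - int h * m"
      using bounds(1) by (simp add: algebra_simps)
    also have "\<dots> = int h * c" by (simp add: k(3) algebra_simps)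
    finally show ?thesis .
  qed
  then have "?x + (?f - 1) * m < c" by (simp add: mult_less_cancel_left)
  then have lower: "?f \<le> steps ?x" using less_steps_iff[of "?f - 1" ?x] by linarith
  have "int h * c \<le> int h * (?x + (?f + 1) * m)"
  proof -
    have "int h * c = int (size N) * c + int k * c" by (simp add: k(3) algebra_simps)
    also have "\<dots> \<le> int (size N) * c + int k * (c + m)" using m by (simp add: algebra_simps)
    also have "\<dots> \<le> int h * ?x + (?f + 1) * (int h * m)"
      using sum_lower[OF sub] bounds(2) by linarith
    finally show ?thesis by (simp add: algebra_simps)
  qed
  then have "c \<le> ?x + (?f + 1) * m" using h by (simp add: mult_le_cancel_left)
  then have upper: "steps ?x \<le> ?f + 1" using less_steps_iff[of "?f + 1" ?x] by linarith
  have "short h a' b' m c (size N) ?x \<longleftrightarrow> steps ?x \<le> ?f"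
    by (simp add: short_def steps_def k_def)
  then show ?thesis unfolding k_def[symmetric] using lower upper by auto
qed

text \<open>The depth is \<open>steps\<close> at the empty sum, so \<open>steps_eq\<close> bounds it
  below. The slope bound at \<open>j = h\<close> reads
  \<open>c + m \<le> (slope_floor h + 1) * m\<close>, that is,
  \<open>c \<le> slope_floor h * m\<close>, which excludes the larger value.\<close>

lemma depth_eq: "depth m c = slope_floor h"
proof -
  have "depth m c = steps 0" by (simp add: depth_def steps_def)
  moreover have "\<not> slope_floor h < steps 0"
  proof -
    have "int h * c \<le> int h * (slope_floor h * m)"
      using slope_floor_bounds(2)[of h] h by (simp add: algebra_simps)
    then have "c \<le> slope_floor h * m" using h by (simp add: mult_le_cancel_left)
    then show ?thesis using less_steps_iff[of "slope_floor h" 0] by simp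
  qed
  moreover have "slope_floor h \<le> steps 0"
    using steps_eq[of "{#}"] h by (auto split: if_splits)
  ultimately show ?thesis by linarith
qed

lemma num_left_elements_eq_long:
  "int (num_left_elements S c) =
    (\<Sum>i<h. int (multichoose (card \<Gamma>) i) * slope_floor (h - i)) + int (num_long h a' b' m c \<Gamma>)"
proof -
  have "int (num_left_elements S c) = (\<Sum>N\<in>small. slope_floor (h - size N)
      + (if short h a' b' m c (size N) (\<Sum>\<^sub># N) then 0 else 1))"
    unfolding num_left_elements_eq by (intro sum.cong refl steps_eq)
  also have "\<dots> = (\<Sum>N\<in>small. slope_floor (h - size N))
      + (\<Sum>N\<in>small. if short h a' b' m c (size N) (\<Sum>\<^sub># N) then 0 else 1)"
    by (rule sum.distrib)
  also have "(\<Sum>N\<in>small. if short h a' b' m c (size N) (\<Sum>\<^sub># N) then 0 else 1)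
      = int (num_long h a' b' m c \<Gamma>)"
  proof -
    have "small \<inter> - {N. short h a' b' m c (size N) (\<Sum>\<^sub># N)}
        = {N \<in> small. \<not> short h a' b' m c (size N) (\<Sum>\<^sub># N)}"
      by blast
    then show ?thesis using finite_small by (simp add: sum.If_cases num_long_eq)
  qed
  finally show ?thesis using sum_small[of "\<lambda>i. slope_floor (h - i)"] by simp
qed

text \<open>With \<open>r = m - s\<close> the term \<open>q r - c\<close> becomes
  \<open>\<rho> - q s\<close>. Together with the main part of \<open>k \<ell>\<close>, the term
  \<open>- q s\<close> forms the functional at \<open>slope_floor\<close>.\<close>

lemma eliahou_eq:
  "real_of_int (eliahou m c S) =
    eliahou_form (card \<Gamma>) h (\<lambda>j. real_of_int (slope_floor j)) + real_of_int (rho m c)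
      + real (num_left_generators S c) * real (num_long h a' b' m c \<Gamma>)"
proof -
  have "eliahou m c S
    = (\<Sum>i<h. int (multichoose (card \<Gamma>) i) * slope_floor (h - i)) * int (Suc (card \<Gamma>))
      - slope_floor h * int (multichoose (Suc (card \<Gamma>)) h) + rho m c
      + int (Suc (card \<Gamma>)) * int (num_long h a' b' m c \<Gamma>)"
    unfolding eliahou_def num_left_elements_eq_long num_left_generators_eq num_right_generators_eq
      card_multisets_le rho_def depth_eq
    by (simp only: algebra_simps)
  then have "real_of_int (eliahou m c S)
    = (\<Sum>i<h. real (multichoose (card \<Gamma>) i) * of_int (slope_floor (h - i))) * real (Suc (card \<Gamma>))
      - of_int (slope_floor h) * real (multichoose (Suc (card \<Gamma>)) h) + of_int (rho m c)
      + real (Suc (card \<Gamma>)) * real (num_long h a' b' m c \<Gamma>)"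
    by simp
  also have "\<dots> = eliahou_form (card \<Gamma>) h (\<lambda>j. real_of_int (slope_floor j)) + real_of_int (rho m c)
      + real (Suc (card \<Gamma>)) * real (num_long h a' b' m c \<Gamma>)"
    unfolding eliahou_form_def by (simp only: mult.commute)
  finally show ?thesis by (simp only: num_left_generators_eq)
qed

end

end

section \<open>The four expressions for \<open>E\<^sub>0\<close>\<close>

theorem theorem3p1:
  fixes h :: nat and a b a' b' \<tau> m :: int and \<Delta> :: "nat set"
    and c \<rho> :: int and \<Gamma> S :: "int set" and l \<omega> s :: nat
    and si :: "nat \<Rightarrow> nat" and \<phi> \<phi>' :: "nat \<Rightarrow> real"
  defines "c \<equiv> conductor_of h a b \<tau> m"
  defines "\<Gamma> \<equiv> Gamma_of h \<Delta> m c"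
  defines "S \<equiv> semigroup_gen m \<Gamma> c"
  defines "\<rho> \<equiv> rho m c"
  defines "l \<equiv> num_left_generators S c"
  defines "\<omega> \<equiv> num_long h a' b' m c \<Gamma>"
  defines "si \<equiv> \<lambda>i. multichoose (l - 1) i"
  defines "s \<equiv> multichoose l h"
  defines "\<phi> \<equiv> \<lambda>i. frac (- (real i * real_of_int a / real_of_int b))"
  defines "\<phi>' \<equiv> \<lambda>i. frac (real i * real_of_int a' / real_of_int b')"
  assumes "h \<ge> 2"
    and "farey h a b" and "farey_predecessor h a b a' b'"
    and "finite \<Delta>" and "0 < m" and "m < c"
    and "standing h a b a' b' m c \<Gamma>"
    and "canonically_defined m \<Gamma> c"
    and "collision_free m c S"
  shows "\<exists>E\<^sub>0 :: real.
    real_of_int (eliahou m c S) = E\<^sub>0 + real_of_int \<rho> + real l * real \<omega> \<and>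
    E\<^sub>0 = - real l * (\<Sum>i = 0..h - 1. \<phi>' (h - i) * real (si i)) + \<phi>' h * real s \<and>
    E\<^sub>0 = - real (h - 1) * real (si h)
         + real l * (\<Sum>i = 0..h - 1. \<phi> (h - i) * real (si i)) - \<phi> h * real s \<and>
    E\<^sub>0 = - real_of_int \<lfloor>real h * \<phi>' 1\<rfloor> * real s
         + real l * (\<Sum>j = 1..\<lfloor>real h * \<phi>' 1\<rfloor>.
             real (multichoose l (nat (int h - \<lceil>real_of_int j / \<phi>' 1\<rceil>)))) \<and>
    E\<^sub>0 = - real (h - 1) * real (si h) + real_of_int \<lfloor>real h * \<phi> 1\<rfloor> * real s
         - real l * (\<Sum>j = 1..\<lfloor>real h * \<phi> 1\<rfloor>.
             real (multichoose l (nat (int h - \<lceil>real_of_int j / \<phi> 1\<rceil>))))"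
proof -
  note h = \<open>2 \<le> h\<close> and m = \<open>0 < m\<close> and pred = \<open>farey_predecessor h a b a' b'\<close>
    and std = \<open>standing h a b a' b' m c \<Gamma>\<close>
  have h0: "0 < h" using h by simp
  have fin: "finite \<Gamma>" using \<open>finite \<Delta>\<close> by (simp add: \<Gamma>_def Gamma_of_def)
  interpret collision_free_semigroup h m c \<Gamma>
  proof
    fix x assume x: "x \<in> \<Gamma>"
    show "m < x" using std x by (simp add: standing_def)
    have "int h * Min \<Gamma> \<le> int h * x" using x fin by (intro mult_left_mono) auto
    then show "c \<le> int h * x" using std x by (auto simp: standing_def)
    \<comment> \<open>Elements of \<open>\<Gamma>\<close> arise from this floor by subtracting
      natural numbers.\<close>
    have "x \<le> \<lfloor>real_of_int (c + m - 1) / real h\<rfloor>"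
      using x by (auto simp: \<Gamma>_def Gamma_of_def)
    then have "real_of_int x * real h \<le> real_of_int (c + m - 1)"
      using h0 by (simp only: le_floor_iff pos_le_divide_eq of_nat_0_less_iff)
    then have "real_of_int (int h * x) \<le> real_of_int (c + m - 1)" by (simp add: mult.commute)
    then show "int h * x < c + m" by (simp only: of_int_le_iff)
  qed (use assms fin in auto)
  define g where "g = card \<Gamma>"
  have l: "l = Suc g" unfolding l_def S_def g_def by (rule num_left_generators_eq)
  define f where "f = (\<lambda>j. \<lfloor>real j * of_int a' / of_int b'\<rfloor>)"
  \<comment> \<open>The witness for \<open>E\<^sub>0\<close>; each of the four expressions is shown
    equal to it.\<close>
  let ?E = "eliahou_form g h (\<lambda>j. real_of_int (f j))"
  have form: "eliahou_form g h F
    = real l * (\<Sum>i = 0..h - 1. F (h - i) * real (si i)) - F h * real s" for F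
  proof -
    have "{..<h} = {0..h - 1}" using h0 by auto
    then show ?thesis by (simp add: eliahou_form_def l si_def s_def)
  qed
  have one: "eliahou_form g h (\<lambda>_. 1) = real (h - 1) * real (si h)"
    using eliahou_form_one[OF h0] by (simp add: si_def l)
  \<comment> \<open>Hence a floor of \<open>j x / y\<close> may be replaced by minus the
    corresponding fractional part.\<close>
  have linear: "eliahou_form g h (\<lambda>j. real j * x / y) = 0" for x y
    using eliahou_form_scale[of g h "x / y" real] eliahou_form_real[OF h0]
    by (simp add: mult.commute)
  \<comment> \<open>The floor becomes a ceiling minus 1, and the ceiling minus the floor of the
    negative; the constant 1 produces the term \<open>(h - 1) s\<^sub>h\<close>. The Farey identity
    covers \<open>1 \<le> j \<le> h\<close>, the only arguments that matter.\<close>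
  have ceil: "?E = - eliahou_form g h (\<lambda>j. real_of_int \<lfloor>- (real j * of_int a / of_int b)\<rfloor>)
      - real (h - 1) * real (si h)"
  proof -
    have "?E = eliahou_form g h (\<lambda>j. - real_of_int \<lfloor>- (real j * of_int a / of_int b)\<rfloor> - 1)"
      using farey_predecessor_floor[OF pred]
      by (intro eliahou_form_cong[OF h0]) (simp add: f_def ceiling_def)
    then show ?thesis by (simp only: eliahou_form_diff eliahou_form_minus one)
  qed
  \<comment> \<open>Applied below to \<open>a'/b'\<close> and \<open>-a/b\<close>, whose fractional
    parts are \<open>\<phi>' 1\<close> and \<open>\<phi> 1\<close>.\<close>
  have floor_sum: "eliahou_form g h (\<lambda>j. real_of_int \<lfloor>real j * x\<rfloor>)
    = real l * (\<Sum>j = 1..\<lfloor>real h * frac x\<rfloor>.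
        real (multichoose l (nat (int h - \<lceil>real_of_int j / frac x\<rceil>))))
      - real_of_int \<lfloor>real h * frac x\<rfloor> * real s" for x
    unfolding eliahou_form_floor_frac[OF h0, of g x] eliahou_form_floor[OF frac_ge_0] l s_def ..
  have "real_of_int (eliahou m c S) = ?E + real_of_int \<rho> + real l * real \<omega>"
    unfolding S_def \<rho>_def l_def \<omega>_def f_def g_def
    using std by (intro eliahou_eq[OF pred]) (simp_all add: standing_def)
  moreover have "?E = - real l * (\<Sum>i = 0..h - 1. \<phi>' (h - i) * real (si i)) + \<phi>' h * real s"
  proof -
    have "(\<lambda>j. real_of_int (f j)) = (\<lambda>j. real j * of_int a' / of_int b' - \<phi>' j)"
      by (simp add: f_def \<phi>'_def frac_def)
    then have "?E = - eliahou_form g h \<phi>'" by (simp only: eliahou_form_diff linear)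
    then show ?thesis by (simp add: form)
  qed
  moreover have "?E = - real (h - 1) * real (si h)
      + real l * (\<Sum>i = 0..h - 1. \<phi> (h - i) * real (si i)) - \<phi> h * real s"
  proof -
    have "(\<lambda>j. real_of_int \<lfloor>- (real j * of_int a / of_int b)\<rfloor>)
        = (\<lambda>j. - (real j * of_int a / of_int b) - \<phi> j)"
      by (simp add: \<phi>_def frac_def)
    then have "?E = eliahou_form g h \<phi> - real (h - 1) * real (si h)"
      unfolding ceil by (simp only: eliahou_form_diff eliahou_form_minus linear)
    then show ?thesis by (simp add: form)
  qed
  moreover have "?E = - real_of_int \<lfloor>real h * \<phi>' 1\<rfloor> * real s
      + real l * (\<Sum>j = 1..\<lfloor>real h * \<phi>' 1\<rfloor>.
          real (multichoose l (nat (int h - \<lceil>real_of_int j / \<phi>' 1\<rceil>))))"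
    using floor_sum[of "of_int a' / of_int b'"] by (simp add: f_def \<phi>'_def)
  moreover have "?E = - real (h - 1) * real (si h) + real_of_int \<lfloor>real h * \<phi> 1\<rfloor> * real s
      - real l * (\<Sum>j = 1..\<lfloor>real h * \<phi> 1\<rfloor>.
          real (multichoose l (nat (int h - \<lceil>real_of_int j / \<phi> 1\<rceil>))))"
    using floor_sum[of "- (of_int a / of_int b)"] by (simp add: ceil \<phi>_def)
  ultimately show ?thesis by blast
qed

end
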